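(* Let $S\in\mathbb{N}$ and let $(\mathbf{X}^s,\mathrm{p}^s)\in\mathbb{R}^{N^s\times N^s}\times\mathcal{P}_{N^s}$, $s\in[S]$, be templates. Let $M\in\mathbb{N}$ and let $\mathrm{q}\in\mathcal{P}_M$ have all entries strictly positive. Let $\lambda\in\Delta_{S-1}$ and let $\mathbf{Y}_\lambda\in\mathrm{Bary}_{M,\mathrm{q}}(\{(\mathbf{X}^s,\mathrm{p}^s)\}_{s\in[S]})$ be an element corresponding to the weight vector $\lambda$, i.e. $$\mathbf{Y}_\lambda\in\operatorname*{arg\,min}_{\mathbf{Y}\in\mathbb{R}^{M\times M}}\sum_{s\in[S]}\lambda_s\,GW((\mathbf{X}^s,\mathrm{p}^s),(\mathbf{Y},\mathrm{q}))^2 .$$ For each $s\in[S]$, let $\pi^{*s}\in\Pi(\mathrm{p}^s,\mathrm{q})$ be an optimal plan for $GW((\mathbf{X}^s,\mathrm{p}^s),(\mathbf{Y}_\lambda,\mathrm{q}))$, and set $$\mathbf{Y}^*_\lambda:=\frac{1}{\mathrm{q}\mathrm{q}^T}\odot\sum_{s\in[S]}\lambda_s\,(\pi^{*s})^T\mathbf{X}^s\pi^{*s}\in\mathbb{R}^{M\times M}.$$ Then $\mathbf{Y}_\lambda=\mathbf{Y}^*_\lambda$.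
   Context: Notation: $[S]=\{1,\dots,S\}$; $\Delta_{S-1}=\{\lambda\in\mathbb{R}^S:\lambda_s\ge 0,\ \sum_{s}\lambda_s=1\}$; $\mathcal{P}_N$ is the set of probability vectors in $\mathbb{R}^N$ with strictly positive entries. For $\mathrm{p}\in\mathcal{P}_N$, $\mathrm{q}\in\mathcal{P}_M$, $\Pi(\mathrm{p},\mathrm{q})=\{\pi\in\mathbb{R}^{N\times M}:\pi_{ij}\ge 0,\ \sum_j\pi_{ij}=\mathrm{p}_i,\ \sum_i\pi_{ij}=\mathrm{q}_j\}$. For $(\mathbf{X},\mathrm{p})\in\mathbb{R}^{N\times N}\times\mathcal{P}_N$ and $(\mathbf{Y},\mathrm{q})\in\mathbb{R}^{M\times M}\times\mathcal{P}_M$ (arbitrary real matrices), the Gromov-Wasserstein discrepancy is $$GW((\mathbf{X},\mathrm{p}),(\mathbf{Y},\mathrm{q}))^2=\min_{\pi\in\Pi(\mathrm{p},\mathrm{q})}\sum_{i,k\in[N]}\sum_{j,l\in[M]}|\mathbf{X}_{ik}-\mathbf{Y}_{jl}|^2\pi_{ij}\pi_{kl};$$ a minimizer $\pi$ is called an optimal plan (optimal coupling). $\odot$ is the entrywise product, and $\frac{1}{\mathrm{q}\mathrm{q}^T}$ is the $M\times M$ matrix with entries $\frac{1}{\mathrm{q}_j\mathrm{q}_l}$. $\mathrm{Bary}_{M,\mathrm{q}}(\{(\mathbf{X}^s,\mathrm{p}^s)\}_{s\in[S]})$ is the set of all matrices $\mathbf{Y}_\lambda\in\mathbb{R}^{M\times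 M}$ that minimize $\mathbf{Y}\mapsto\sum_{s\in[S]}\lambda_s GW((\mathbf{X}^s,\mathrm{p}^s),(\mathbf{Y},\mathrm{q}))^2$ over $\mathbb{R}^{M\times M}$ for some $\lambda\in\Delta_{S-1}$. *)

theory Defs
  imports Complex_Main "Jordan_Normal_Form.Matrix"
begin

text \<open>All index sets are zero-based: \<open>[S]\<close> is \<open>{..<S}\<close>, and vectors and matrices carry their
  dimensions at the value level, so that the sizes of the templates may depend on \<open>s\<close>.\<close>

definition simplex :: "nat \<Rightarrow> real vec set" where
  "simplex S = {lam \<in> carrier_vec S. (\<forall>s<S. 0 \<le> lam $ s) \<and> (\<Sum>s<S. lam $ s) = 1}"

definition pos_prob :: "nat \<Rightarrow> real vec set" where
  "pos_prob N = {p \<in> carrier_vec N. (\<forall>i<N. 0 < p $ i) \<and> (\<Sum>i<N. p $ i) = 1}"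

definition couplings :: "real vec \<Rightarrow> real vec \<Rightarrow> real mat set" where
  "couplings p q = {P \<in> carrier_mat (dim_vec p) (dim_vec q).
     (\<forall>i<dim_vec p. \<forall>j<dim_vec q. 0 \<le> P $$ (i, j)) \<and>
     (\<forall>i<dim_vec p. (\<Sum>j<dim_vec q. P $$ (i, j)) = p $ i) \<and>
     (\<forall>j<dim_vec q. (\<Sum>i<dim_vec p. P $$ (i, j)) = q $ j)}"

fun GW_cost :: "real mat \<times> real vec \<Rightarrow> real mat \<times> real vec \<Rightarrow> real mat \<Rightarrow> real" where
  "GW_cost (X, p) (Y, q) P =
     (\<Sum>i<dim_vec p. \<Sum>k<dim_vec p. \<Sum>j<dim_vec q. \<Sum>l<dim_vec q.
        \<bar>X $$ (i, k) - Y $$ (j, l)\<bar>\<^sup>2 * P $$ (i, j) * P $$ (k, l))"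

text \<open>For probability vectors \<open>p\<close>, \<open>q\<close> the set \<open>couplings p q\<close> is nonempty and compact and the cost is
  continuous and nonnegative, so the infimum below is a minimum.\<close>

definition GW :: "real mat \<times> real vec \<Rightarrow> real mat \<times> real vec \<Rightarrow> real" where
  "GW A B = sqrt (INF P\<in>couplings (snd A) (snd B). GW_cost A B P)"

definition optimal_plan :: "real mat \<times> real vec \<Rightarrow> real mat \<times> real vec \<Rightarrow> real mat \<Rightarrow> bool" where
  "optimal_plan A B P \<longleftrightarrow> is_arg_min (GW_cost A B) (\<lambda>P. P \<in> couplings (snd A) (snd B)) P"

definition bary_objective ::
  "nat \<Rightarrow> (nat \<Rightarrow> real mat \<times> real vec) \<Rightarrow> real vec \<Rightarrow> real vec \<Rightarrow> real mat \<Rightarrow> real" where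
  "bary_objective S T q lam Y = (\<Sum>s<S. lam $ s * (GW (T s) (Y, q))\<^sup>2)"

definition is_bary ::
  "nat \<Rightarrow> real vec \<Rightarrow> nat \<Rightarrow> (nat \<Rightarrow> real mat \<times> real vec) \<Rightarrow> real vec \<Rightarrow> real mat \<Rightarrow> bool" where
  "is_bary M q S T lam Y \<longleftrightarrow>
     is_arg_min (bary_objective S T q lam) (\<lambda>Y. Y \<in> carrier_mat M M) Y"

definition Bary ::
  "nat \<Rightarrow> real vec \<Rightarrow> nat \<Rightarrow> (nat \<Rightarrow> real mat \<times> real vec) \<Rightarrow> real mat set" where
  "Bary M q S T = {Y. \<exists>lam\<in>simplex S. is_bary M q S T lam Y}"

definition hadamard :: "real mat \<Rightarrow> real mat \<Rightarrow> real mat" (infixl \<open>\<odot>\<^sub>m\<close> 70) where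
  "A \<odot>\<^sub>m B = mat (dim_row A) (dim_col A) (\<lambda>(i, j). A $$ (i, j) * B $$ (i, j))"

definition inv_outer :: "real vec \<Rightarrow> real mat" where
  "inv_outer q = mat (dim_vec q) (dim_vec q) (\<lambda>(j, l). 1 / (q $ j * q $ l))"

text \<open>The type of matrices of all sizes has no zero, so the sum over \<open>s\<close> is taken in the module of
  \<open>M \<times> M\<close> matrices.\<close>

definition bary_formula ::
  "nat \<Rightarrow> real vec \<Rightarrow> nat \<Rightarrow> (nat \<Rightarrow> real mat) \<Rightarrow> real vec \<Rightarrow> (nat \<Rightarrow> real mat) \<Rightarrow> real mat" where
  "bary_formula M q S X lam P =
     inv_outer q \<odot>\<^sub>m
       finsum (module_mat TYPE(real) M M)
         (\<lambda>s. lam $ s \<cdot>\<^sub>m (transpose_mat (P s) * X s * P s)) {..<S}"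

end

theory Submission
  imports Defs
begin

text \<open>Freezing the plans \<open>P s\<close>, the weighted sum of costs is an upper bound for the barycenter
  objective that is attained at \<open>Y\<close>, so \<open>Y\<close> also minimizes it. As the marginals of every plan are
  fixed, that upper bound is, up to an additive constant, the weighted least-squares functional
  \<open>\<Sum>j l. q j * q l * (Y j l - Y* j l)\<^sup>2\<close>, whose only minimizer is \<open>Y*\<close>.\<close>

lemma sum_rotate:
  "(\<Sum>i\<in>A. \<Sum>j\<in>B. \<Sum>l\<in>C. f i j l) = (\<Sum>j\<in>B. \<Sum>l\<in>C. \<Sum>i\<in>A. f i j l)"
  by (subst sum.swap, rule sum.cong[OF refl], rule sum.swap)

text \<open>An entry of \<open>transpose_mat P * X * P\<close>, kept as a double sum because the
  cross term of the expanded cost arises in this shape.\<close>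

definition pulled_back :: "nat \<Rightarrow> real mat \<Rightarrow> real mat \<Rightarrow> nat \<Rightarrow> nat \<Rightarrow> real" where
  "pulled_back n X P j l = (\<Sum>i<n. \<Sum>k<n. X $$ (i, k) * P $$ (i, j) * P $$ (k, l))"

lemma index_transpose_mult_mult:
  assumes "X \<in> carrier_mat n n" "P \<in> carrier_mat n m" "j < m" "l < m"
  shows "(transpose_mat P * X * P) $$ (j, l) = pulled_back n X P j l"
proof -
  have "(transpose_mat P * X * P) $$ (j, l) = (\<Sum>k<n. (\<Sum>i<n. P $$ (i, j) * X $$ (i, k)) * P $$ (k, l))"
    using assms by (simp add: scalar_prod_def lessThan_atLeast0 del: assoc_mult_mat)
  also have "\<dots> = pulled_back n X P j l"
    unfolding pulled_back_def by (subst sum.swap) (simp add: sum_distrib_left mult_ac)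
  finally show ?thesis .
qed

text \<open>Brings the module sum inside \<open>bary_formula\<close> back to ordinary sums of
  entries. Induction over the index set works because zero and addition of the module are the
  entrywise ones.\<close>

lemma index_finsum_module_mat:
  assumes "finite A" "\<And>s. s \<in> A \<Longrightarrow> f s \<in> carrier_mat n m" "j < n" "l < m"
  shows "finsum (module_mat TYPE('a::comm_ring_1) n m) f A $$ (j, l) = (\<Sum>s\<in>A. f s $$ (j, l))"
proof -
  let ?G = "module_mat TYPE('a) n m"
  interpret abelian_group ?G
    by (rule abelian_group_mat)
  show ?thesis
    using assms(1,2)
  proof (induction A rule: finite_induct)
    case empty
    then show ?case using assms(3,4) by (simp add: module_mat_simps)
  next
    case (insert s A)
    have f: "f \<in> A \<rightarrow> carrier ?G" "f s \<in> carrier ?G"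
      using insert.prems by (auto simp: module_mat_simps)
    have "finsum ?G f A \<in> carrier ?G"
      using f(1) by (rule finsum_closed)
    then have "finsum ?G f A \<in> carrier_mat n m"
      by (simp add: module_mat_simps)
    then show ?case
      using insert f assms(3,4) by (simp add: finsum_insert) (simp add: module_mat_simps)
  qed
qed

text \<open>Expand the square. The first sum is free of \<open>Y\<close>. In the second, the column
  marginals of \<open>P\<close> turn the coefficient of the quadratic term into
  \<open>q $ j * q $ l\<close>, the same for every coupling, so \<open>P\<close> survives only in
  the linear term.\<close>

lemma GW_cost_expand:
  assumes "P \<in> couplings p q"
  shows "GW_cost (X, p) (Y, q) P =
     (\<Sum>i<dim_vec p. \<Sum>k<dim_vec p. \<Sum>j<dim_vec q. \<Sum>l<dim_vec q.
        (X $$ (i, k))\<^sup>2 * P $$ (i, j) * P $$ (k, l)) +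
     (\<Sum>j<dim_vec q. \<Sum>l<dim_vec q.
        (Y $$ (j, l))\<^sup>2 * (q $ j * q $ l) - 2 * Y $$ (j, l) * pulled_back (dim_vec p) X P j l)"
    (is "_ = ?A + ?B")
proof -
  let ?n = "dim_vec p" and ?m = "dim_vec q"
  have marg: "(\<Sum>i<?n. P $$ (i, j)) = q $ j" if "j < ?m" for j
    using assms that by (simp add: couplings_def)
  have "GW_cost (X, p) (Y, q) P =
      (\<Sum>i<?n. \<Sum>k<?n. \<Sum>j<?m. \<Sum>l<?m. (X $$ (i, k))\<^sup>2 * P $$ (i, j) * P $$ (k, l) +
        ((Y $$ (j, l))\<^sup>2 * (P $$ (i, j) * P $$ (k, l)) -
         2 * Y $$ (j, l) * (X $$ (i, k) * P $$ (i, j) * P $$ (k, l))))"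
    by (auto intro!: sum.cong simp: power2_eq_square algebra_simps)
  also have "\<dots> = ?A + (\<Sum>i<?n. \<Sum>k<?n. \<Sum>j<?m. \<Sum>l<?m.
        (Y $$ (j, l))\<^sup>2 * (P $$ (i, j) * P $$ (k, l)) -
         2 * Y $$ (j, l) * (X $$ (i, k) * P $$ (i, j) * P $$ (k, l)))" (is "_ = _ + ?C")
    by (simp only: sum.distrib)
  also have "?C = (\<Sum>j<?m. \<Sum>l<?m. \<Sum>i<?n. \<Sum>k<?n.
        (Y $$ (j, l))\<^sup>2 * (P $$ (i, j) * P $$ (k, l)) -
         2 * Y $$ (j, l) * (X $$ (i, k) * P $$ (i, j) * P $$ (k, l)))"
    \<comment> \<open>Rotates twice, moving first \<open>k\<close> and then \<open>i\<close> inside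
      \<open>j\<close> and \<open>l\<close>. Fixing the index sets orients the rewriting, which
      would otherwise loop.\<close>
    by (simp only: sum_rotate[where A = "{..<?n}" and B = "{..<?m}" and C = "{..<?m}"])
  also have "\<dots> = ?B"
  proof (intro sum.cong refl)
    fix j l assume jl: "j \<in> {..<?m}" "l \<in> {..<?m}"
    \<comment> \<open>The double sum factors into the product of the column sums at \<open>j\<close>
      and \<open>l\<close>.\<close>
    have "(\<Sum>i<?n. \<Sum>k<?n. P $$ (i, j) * P $$ (k, l)) = q $ j * q $ l"
      using jl by (simp add: marg flip: sum_product)
    then show "(\<Sum>i<?n. \<Sum>k<?n. (Y $$ (j, l))\<^sup>2 * (P $$ (i, j) * P $$ (k, l)) -
         2 * Y $$ (j, l) * (X $$ (i, k) * P $$ (i, j) * P $$ (k, l))) =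
        (Y $$ (j, l))\<^sup>2 * (q $ j * q $ l) - 2 * Y $$ (j, l) * pulled_back ?n X P j l"
      by (simp only: sum_subtractf pulled_back_def flip: sum_distrib_left)
  qed
  finally show ?thesis .
qed

lemma GW_cost_nonneg:
  assumes "P \<in> couplings p q"
  shows "0 \<le> GW_cost (X, p) (Y, q) P"
  using assms by (auto simp: couplings_def intro!: sum_nonneg mult_nonneg_nonneg)

text \<open>Nonnegative costs serve twice: they bound the set below, so that its infimum lies below
  each member, and they let the square cancel the \<open>sqrt\<close> in \<open>GW\<close>.\<close>

lemma GW_power2_le:
  assumes "P \<in> couplings p q"
  shows "(GW (X, p) (Y, q))\<^sup>2 \<le> GW_cost (X, p) (Y, q) P"
proof -
  have "0 \<le> (INF P\<in>couplings p q. GW_cost (X, p) (Y, q) P)"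
    using assms by (intro cINF_greatest GW_cost_nonneg) auto
  moreover have "(INF P\<in>couplings p q. GW_cost (X, p) (Y, q) P) \<le> GW_cost (X, p) (Y, q) P"
    using assms by (intro cINF_lower bdd_belowI2[where m = 0] GW_cost_nonneg)
  ultimately show ?thesis
    by (simp add: GW_def)
qed

text \<open>The given plan attains the infimum, so no compactness argument enters.\<close>

lemma GW_power2_eq:
  assumes "optimal_plan (X, p) (Y, q) P"
  shows "(GW (X, p) (Y, q))\<^sup>2 = GW_cost (X, p) (Y, q) P"
proof -
  have P: "P \<in> couplings p q"
    and min: "\<And>Q. Q \<in> couplings p q \<Longrightarrow> GW_cost (X, p) (Y, q) P \<le> GW_cost (X, p) (Y, q) Q"
    using assms by (auto simp: optimal_plan_def is_arg_min_linorder simp del: GW_cost.simps)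
  have "(INF P\<in>couplings p q. GW_cost (X, p) (Y, q) P) = GW_cost (X, p) (Y, q) P"
    using P min by (intro cInf_eq_minimum) auto
  then show ?thesis
    using GW_cost_nonneg[OF P] by (simp add: GW_def del: GW_cost.simps)
qed

theorem theorem3p3:
  fixes S M :: nat and N :: "nat \<Rightarrow> nat"
    and X :: "nat \<Rightarrow> real mat" and p :: "nat \<Rightarrow> real vec"
    and q lam :: "real vec" and Y :: "real mat" and P :: "nat \<Rightarrow> real mat"
  assumes "\<And>s. s < S \<Longrightarrow> X s \<in> carrier_mat (N s) (N s)"
    and "\<And>s. s < S \<Longrightarrow> p s \<in> pos_prob (N s)"
    and "q \<in> pos_prob M"
    and "lam \<in> simplex S"
    and "Y \<in> Bary M q S (\<lambda>s. (X s, p s))"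
    and "is_bary M q S (\<lambda>s. (X s, p s)) lam Y"
    and "\<And>s. s < S \<Longrightarrow> optimal_plan (X s, p s) (Y, q) (P s)"
  shows "Y = bary_formula M q S X lam P"
proof -
  define Z where "Z = bary_formula M q S X lam P"
  \<comment> \<open>\<open>W\<close> holds the linear coefficients of \<open>F\<close>, the
    objective with frozen plans.\<close>
  define W where "W j l = (\<Sum>s<S. lam $ s * pulled_back (N s) (X s) (P s) j l)" for j l
  define F where "F V = (\<Sum>s<S. lam $ s * GW_cost (X s, p s) (V, q) (P s))" for V
  have q: "dim_vec q = M" "\<And>j. j < M \<Longrightarrow> 0 < q $ j"
    using assms(3) by (auto simp: pos_prob_def)
  have lam: "0 \<le> lam $ s" if "s < S" for s
    using assms(4) that by (simp add: simplex_def)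
  have sum_lam: "(\<Sum>s<S. lam $ s) = 1"
    using assms(4) by (simp add: simplex_def)
  have p: "dim_vec (p s) = N s" if "s < S" for s
    using assms(2)[OF that] by (simp add: pos_prob_def)
  have P: "P s \<in> couplings (p s) q" if "s < S" for s
    using assms(7)[OF that] by (simp add: optimal_plan_def is_arg_min_def)
  then have Pc: "P s \<in> carrier_mat (N s) M" if "s < S" for s
    using that p q(1) by (simp add: couplings_def)
  have Y: "Y \<in> carrier_mat M M"
    and Ymin: "\<And>V. V \<in> carrier_mat M M \<Longrightarrow>
      bary_objective S (\<lambda>s. (X s, p s)) q lam Y \<le> bary_objective S (\<lambda>s. (X s, p s)) q lam V"
    using assms(6) by (auto simp: is_bary_def is_arg_min_linorder)
  have Z: "Z \<in> carrier_mat M M"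
    using q(1) by (simp add: Z_def bary_formula_def hadamard_def inv_outer_def)
  \<comment> \<open>This is the stationarity condition of the quadratic \<open>F\<close> at
    \<open>Z\<close>; the division by \<open>q $ j * q $ l\<close> in \<open>inv_outer\<close> can
    be undone since \<open>q\<close> is positive.\<close>
  have W_Z: "W j l = q $ j * q $ l * Z $$ (j, l)" if jl: "j < M" "l < M" for j l
  proof -
    have car: "lam $ s \<cdot>\<^sub>m (transpose_mat (P s) * X s * P s) \<in> carrier_mat M M" if "s < S" for s
      using Pc[OF that] by (intro carrier_matI) auto
    have "Z $$ (j, l) = 1 / (q $ j * q $ l) *
        (\<Sum>s<S. (lam $ s \<cdot>\<^sub>m (transpose_mat (P s) * X s * P s)) $$ (j, l))"
      using jl q(1) car by (subst index_finsum_module_mat[symmetric])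
        (auto simp: Z_def bary_formula_def hadamard_def inv_outer_def)
    also have "(\<Sum>s<S. (lam $ s \<cdot>\<^sub>m (transpose_mat (P s) * X s * P s)) $$ (j, l)) = W j l"
      unfolding W_def
    proof (intro sum.cong refl)
      fix s assume "s \<in> {..<S}"
      then have s: "s < S" by simp
      have "(lam $ s \<cdot>\<^sub>m (transpose_mat (P s) * X s * P s)) $$ (j, l) =
          lam $ s * (transpose_mat (P s) * X s * P s) $$ (j, l)"
        using Pc[OF s] jl by (intro index_smult_mat(1)) auto
      then show "(lam $ s \<cdot>\<^sub>m (transpose_mat (P s) * X s * P s)) $$ (j, l) =
          lam $ s * pulled_back (N s) (X s) (P s) j l"
        using index_transpose_mult_mult[OF assms(1)[OF s] Pc[OF s] jl] by simp
    qed
    finally show ?thesis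
      using q(2)[OF jl(1)] q(2)[OF jl(2)] by simp
  qed
  obtain c where F: "F V = c + (\<Sum>j<M. \<Sum>l<M. (V $$ (j, l))\<^sup>2 * (q $ j * q $ l) - 2 * V $$ (j, l) * W j l)"
    for V
  proof
    fix V
    let ?A = "\<lambda>s. \<Sum>i<N s. \<Sum>k<N s. \<Sum>j<M. \<Sum>l<M. (X s $$ (i, k))\<^sup>2 * P s $$ (i, j) * P s $$ (k, l)"
    let ?b = "\<lambda>s j l. (V $$ (j, l))\<^sup>2 * (q $ j * q $ l) -
      2 * V $$ (j, l) * pulled_back (N s) (X s) (P s) j l"
    have "F V = (\<Sum>s<S. lam $ s * (?A s + (\<Sum>j<M. \<Sum>l<M. ?b s j l)))"
      unfolding F_def using P by (intro sum.cong refl) (simp add: GW_cost_expand p q(1) del: GW_cost.simps)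
    also have "\<dots> = (\<Sum>s<S. lam $ s * ?A s) + (\<Sum>s<S. \<Sum>j<M. \<Sum>l<M. lam $ s * ?b s j l)"
      by (simp only: distrib_left sum.distrib sum_distrib_left)
    also have "(\<Sum>s<S. \<Sum>j<M. \<Sum>l<M. lam $ s * ?b s j l) = (\<Sum>j<M. \<Sum>l<M. \<Sum>s<S. lam $ s * ?b s j l)"
      by (rule sum_rotate)
    also have "\<dots> = (\<Sum>j<M. \<Sum>l<M. (V $$ (j, l))\<^sup>2 * (q $ j * q $ l) - 2 * V $$ (j, l) * W j l)"
    proof (intro sum.cong refl)
      fix j l
      have "(\<Sum>s<S. lam $ s * ?b s j l) =
          (\<Sum>s<S. lam $ s * ((V $$ (j, l))\<^sup>2 * (q $ j * q $ l)) -
            2 * V $$ (j, l) * (lam $ s * pulled_back (N s) (X s) (P s) j l))"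
        by (intro sum.cong refl) (simp add: algebra_simps)
      also have "\<dots> = (\<Sum>s<S. lam $ s) * ((V $$ (j, l))\<^sup>2 * (q $ j * q $ l)) - 2 * V $$ (j, l) * W j l"
        by (simp only: sum_subtractf W_def sum_distrib_left sum_distrib_right)
      \<comment> \<open>The weights sum to one, so the quadratic coefficient stays
        \<open>q $ j * q $ l\<close>.\<close>
      finally show "(\<Sum>s<S. lam $ s * ?b s j l) =
          (V $$ (j, l))\<^sup>2 * (q $ j * q $ l) - 2 * V $$ (j, l) * W j l"
        by (simp add: sum_lam)
    qed
    finally show "F V = (\<Sum>s<S. lam $ s * ?A s) +
        (\<Sum>j<M. \<Sum>l<M. (V $$ (j, l))\<^sup>2 * (q $ j * q $ l) - 2 * V $$ (j, l) * W j l)" .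
  qed
  \<comment> \<open>Equality holds at \<open>Y\<close> because each \<open>P s\<close> is optimal
    there. At \<open>Z\<close> the plans are merely couplings, which still gives the upper bound
    \<open>F Z\<close>.\<close>
  have "F Y = bary_objective S (\<lambda>s. (X s, p s)) q lam Y"
    unfolding F_def bary_objective_def
    by (intro sum.cong refl) (simp add: GW_power2_eq[OF assms(7)] del: GW_cost.simps)
  also have "\<dots> \<le> bary_objective S (\<lambda>s. (X s, p s)) q lam Z"
    using Z by (rule Ymin)
  also have "\<dots> \<le> F Z"
    unfolding F_def bary_objective_def by (intro sum_mono mult_left_mono GW_power2_le P lam) auto
  finally have "F Y - F Z \<le> 0" by simp
  \<comment> \<open>Completing the square: \<open>c\<close> cancels, and with \<open>W_Z\<close>
    each summand is \<open>q $ j * q $ l\<close> times y^2 - 2yz + z^2, where y and z are the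
    entries of \<open>Y\<close> and \<open>Z\<close>.\<close>
  also have "F Y - F Z = (\<Sum>j<M. \<Sum>l<M. q $ j * q $ l * (Y $$ (j, l) - Z $$ (j, l))\<^sup>2)"
    unfolding F by (simp add: W_Z power2_eq_square algebra_simps flip: sum_subtractf)
  finally have le: "(\<Sum>j<M. \<Sum>l<M. q $ j * q $ l * (Y $$ (j, l) - Z $$ (j, l))\<^sup>2) \<le> 0" .
  have nonneg: "0 \<le> q $ j * q $ l * (Y $$ (j, l) - Z $$ (j, l))\<^sup>2" if "j < M" "l < M" for j l
    using that by (simp add: q(2) less_imp_le)
  have "Y $$ (j, l) = Z $$ (j, l)" if jl: "j < M" "l < M" for j l
  proof -
    \<comment> \<open>A sum of nonnegative terms that is at most zero vanishes term by term; this is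
      peeled off first over \<open>j\<close>, then over \<open>l\<close>, and the positive weights
      are cancelled last.\<close>
    have "(\<Sum>j<M. \<Sum>l<M. q $ j * q $ l * (Y $$ (j, l) - Z $$ (j, l))\<^sup>2) = 0"
      using le nonneg by (intro antisym sum_nonneg) auto
    then have "(\<Sum>l<M. q $ j * q $ l * (Y $$ (j, l) - Z $$ (j, l))\<^sup>2) = 0"
      using jl nonneg by (subst (asm) sum_nonneg_eq_0_iff) (auto intro!: sum_nonneg)
    then have "q $ j * q $ l * (Y $$ (j, l) - Z $$ (j, l))\<^sup>2 = 0"
      using jl nonneg by (subst (asm) sum_nonneg_eq_0_iff) auto
    then show ?thesis
      using q(2)[OF jl(1)] q(2)[OF jl(2)] by simp
  qed
  then have "Y = Z"
    using Y Z by (intro eq_matI) auto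
  then show ?thesis
    by (simp add: Z_def)
qed

end
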